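(* Let $b,n$ be nonnegative integers and $1\le u_1<\dots<u_n\le b+2n$ integers. Let $f^+_{b,n,(u_i)_1^n}(a)=M(V^+_{a,b,n,(u_i)_1^n})$ and $\overline f^+_{b,n,(u_i)_1^n}(a)=M(\overline V^+_{a,b,n,(u_i)_1^n})$, regarded as polynomials in $a$ (so they may be evaluated at non-integer real $a$). Then $$\overline f^+_{b,n,(u_i)_1^n}(a)=f^+_{b,n,(u_i)_1^n}(a-1/2).$$
   Context: Work on the triangular lattice of the plane with some lattice lines horizontal; its unit equilateral triangles are called triangles. A lozenge is the union of two triangles sharing an edge; a lozenge tiling of a region (a union of triangles) is a covering of it by lozenges contained in it with pairwise disjoint interiors. If lozenges carry weights, the weight of a tiling is the product of the weights of its lozenges, and $M(R)$ is the sum of the weights of all tilings of $R$ (the number of tilings if all weights are 1). A vertical lozenge is one consisting of two triangles sharing a horizontal edge. $H_{a,b,c,t}$ is the equiangular hexagonal region with side lengths $a,b+t,c,a+t,b,c+t$ read clockwise from the northern (horizontal) side. For $1\le u_1<\dots<u_m\le b+t$ and $1\le v_1<\dots<v_k\le c+t$, $H_{a,b,c,t,(u_i)_1^m,(v_j)_1^k}$ is obtained from $H_{a,b,c,t}$ by removing the $u_i$-th triangle along the northeast side (counting from the north the triangles sharing an edge with that side) for each $i$, and the $v_j$-th triangle along the northwest side (counted likewise) for each $j$. For nonnegative integers $a,b,n$ and $1\le u_1<\dots<u_n\le b+2n$, the region $H_{2a,b,b,2n,(u_i)_1^n,(u_i)_1^n}$ is symmetric about a vertical line $L$. $V^+_{a,b,n,(u_i)_1^n}$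 is the (unweighted) region of triangles of this hexagon whose interiors lie weakly west of $L$ (including triangles bisected by $L$), and $\overline V^+_{a,b,n,(u_i)_1^n}$ is the same region with the vertical lozenges lying on $L$ given weight $1/2$ and all other lozenges weight $1$. The functions $a\mapsto f^+_{b,n,(u_i)_1^n}(a)$ and $a\mapsto\overline f^+_{b,n,(u_i)_1^n}(a)$, defined for $a\in\mathbb N$, are polynomials in $a$. *)

theory Defs
  imports "HOL-Computational_Algebra.Polynomial" "HOL-Library.Disjoint_Sets"
begin

text \<open>
  The pair (x, y) of integers with x + y even stands for the point of the triangular lattice
  with Cartesian coordinates (x / 2, - (sqrt 3 / 2) * y): the first coordinate counts
  half-units eastwards, the second one counts lattice rows downwards (southwards).

  A unit triangle is encoded by a pair (i, j) of integers: it is the unique unit triangle lying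
  between the horizontal lattice lines y = j - 1 and y = j whose vertical symmetry axis is the
  line x = i.  It points up if i + j is odd and down if i + j is even.
\<close>

type_synonym tri = "int \<times> int"

fun vertices :: "tri \<Rightarrow> (int \<times> int) set" where
  "vertices (i, j) =
     (if odd (i + j) then {(i, j - 1), (i - 1, j), (i + 1, j)}
      else {(i - 1, j - 1), (i + 1, j - 1), (i, j)})"

definition lozenge :: "tri set \<Rightarrow> bool" where
  "lozenge l \<longleftrightarrow> (\<exists>s t. l = {s, t} \<and> card (vertices s \<inter> vertices t) = 2)"

definition vertical_lozenge :: "tri set \<Rightarrow> bool" where
  "vertical_lozenge l \<longleftrightarrow>
     (\<exists>s t p q. l = {s, t} \<and> vertices s \<inter> vertices t = {p, q} \<and> p \<noteq> q \<and> snd p = snd q)"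

definition lozenge_tiling :: "tri set \<Rightarrow> tri set set \<Rightarrow> bool" where
  "lozenge_tiling R T \<longleftrightarrow> (\<forall>l\<in>T. lozenge l) \<and> partition_on R T"

definition weighted_tilings :: "(tri set \<Rightarrow> real) \<Rightarrow> tri set \<Rightarrow> real" where
  "weighted_tilings w R = (\<Sum>T | lozenge_tiling R T. \<Prod>l\<in>T. w l)"

text \<open>
  The hexagon with side lengths a, b + t, c, a + t, b, c + t (clockwise from the northern side),
  placed with its north-western corner at the origin.  Its corners, clockwise, are
  (0, 0), (2a, 0), (2a + b + t, b + t), (2a + b + t - c, b + c + t), (- t - c + b, b + c + t),
  (- c - t, c + t).  It is the intersection of the six half-planes bounded by its sides, and,
  being convex, contains a triangle iff it contains the three vertices.
\<close>

definition hexagon :: "nat \<Rightarrow> nat \<Rightarrow> nat \<Rightarrow> nat \<Rightarrow> tri set" where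
  "hexagon a b c t =
     {s. \<forall>(x, y) \<in> vertices s.
           0 \<le> y \<and> y \<le> int (b + c + t) \<and>
           x - y \<le> 2 * int a \<and> x + y \<le> 2 * int (a + b + t) \<and>
           - 2 * int (c + t) \<le> x - y \<and> 0 \<le> x + y}"

lemma finite_hexagon: "finite (hexagon a b c t)"
proof -
  let ?N = "2 * int (a + b + c + t) + 3"
  have "hexagon a b c t \<subseteq> {-?N..?N} \<times> {-?N..?N}"
    by (auto simp: hexagon_def split: if_splits)
  then show ?thesis by (rule finite_subset) auto
qed

text \<open>
  The k-th unit segment from the north on the northeast side joins (2a + k - 1, k - 1) and
  (2a + k, k); the one on the northwest side joins (1 - k, k - 1) and (- k, k).  The triangles
  of the hexagon having these segments as edges are the following ones, both pointing up.
\<close>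

definition ne_triangle :: "nat \<Rightarrow> nat \<Rightarrow> tri" where
  "ne_triangle a k = (2 * int a + int k - 1, int k)"

definition nw_triangle :: "nat \<Rightarrow> tri" where
  "nw_triangle k = (1 - int k, int k)"

definition dented_hexagon ::
  "nat \<Rightarrow> nat \<Rightarrow> nat \<Rightarrow> nat \<Rightarrow> nat \<Rightarrow> (nat \<Rightarrow> nat) \<Rightarrow> nat \<Rightarrow> (nat \<Rightarrow> nat) \<Rightarrow> tri set" where
  "dented_hexagon a b c t m u k v =
     hexagon a b c t - (\<lambda>i. ne_triangle a (u i)) ` {1..m} - (\<lambda>j. nw_triangle (v j)) ` {1..k}"

text \<open>
  The northern side of the hexagon with parameters 2a, b, b, 2n joins (0, 0) and (4a, 0), so its
  vertical symmetry axis L is the line x = 2a.  A triangle (i, j) is bisected by L iff i = 2a;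
  otherwise it lies entirely on one side of L, namely on the western one iff i < 2a.
\<close>

definition V_plus :: "nat \<Rightarrow> nat \<Rightarrow> nat \<Rightarrow> (nat \<Rightarrow> nat) \<Rightarrow> tri set" where
  "V_plus a b n u =
     {s \<in> dented_hexagon (2 * a) b b (2 * n) n u n u. fst s \<le> 2 * int a}"

definition axis_weight :: "nat \<Rightarrow> tri set \<Rightarrow> real" where
  "axis_weight a l =
     (if vertical_lozenge l \<and> (\<forall>s\<in>l. fst s = 2 * int a) then 1 / 2 else 1)"

definition f_plus :: "nat \<Rightarrow> nat \<Rightarrow> (nat \<Rightarrow> nat) \<Rightarrow> nat \<Rightarrow> real" where
  "f_plus b n u a = weighted_tilings (\<lambda>_. 1) (V_plus a b n u)"

definition fbar_plus :: "nat \<Rightarrow> nat \<Rightarrow> (nat \<Rightarrow> nat) \<Rightarrow> nat \<Rightarrow> real" where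
  "fbar_plus b n u a = weighted_tilings (axis_weight a) (V_plus a b n u)"

end

theory Submission
  imports Defs "Jordan_Normal_Form.Determinant"
begin

text \<open>
  A tiling is determined row by row by the positions of the vertical lozenges, and the positions
  on consecutive horizontal lines interlace. Let \<open>d\<close> be the distance of a triangle from the axis and
  use the coordinate \<open>z = d\<close> in the weighted and \<open>z = d + 1\<close> in the unweighted model. By induction on
  the rows, the weight of the tilings of the upper \<open>J\<close> rows with given up-pointing triangles removed
  from row \<open>J\<close> is a determinant with one row per removed triangle or dent, with the entries
  \<open>E\<^sub>k(z) = binomial((z + k - 1) / 2, k)\<close> for \<open>k = J - 1, J - 3, \<dots>\<close>: the step only uses
  \<open>E\<^sub>k(z + 1) - E\<^sub>k(z - 1) = E\<^bsub>k-1\<^esub>(z)\<close> and, at the axis, the parity of \<open>E\<^sub>k\<close>, which turns the weight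
  1/2 at \<open>z = 0\<close> in one model and the absence of \<open>z = 0\<close> in the other into the same boundary term.
  The dents lie at \<open>2 a\<close> (or \<open>2 a + 1\<close>) plus a constant, so both counts are values of one and
  the same polynomial \<open>P\<close>, at \<open>2 a\<close> and \<open>2 a + 1\<close>, respectively.
\<close>

subsection \<open>Determinants of lists of rows\<close>

text \<open>A list of the wrong length gets the value 0, which suits the counts below: the
  corresponding regions have no tiling.\<close>

definition row_det :: "nat \<Rightarrow> (nat \<Rightarrow> real) list \<Rightarrow> real" where
  "row_det q us = (if length us = q then det (mat q q (\<lambda>(i, j). (us ! i) j)) else 0)"

lemma row_det_Leibniz:
  assumes "length us = q"
  shows "row_det q us =
    (\<Sum>p | p permutes {0..<q}. signof p * (\<Prod>i = 0..<q. (us ! i) (p i)))"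
proof -
  have "(\<Prod>i = 0..<q. mat q q (\<lambda>(i, j). (us ! i) j) $$ (i, p i)) = (\<Prod>i = 0..<q. (us ! i) (p i))"
    if "p permutes {0..<q}" for p
    by (rule prod.cong) (use permutes_in_image[OF that] in auto)
  then show ?thesis
    using assms by (simp add: row_det_def det_def)
qed

text \<open>The zero row is a placeholder at the skipped index, so the second factor does not depend
  on \<open>f\<close>, and linearity in that row becomes visible.\<close>

lemma row_det_split:
  assumes "length (us @ f # vs) = q"
  shows "row_det q (us @ f # vs) =
    (\<Sum>p | p permutes {0..<q}. signof p * (f (p (length us)) *
      (\<Prod>i \<in> {0..<q} - {length us}. ((us @ (\<lambda>_. 0) # vs) ! i) (p i))))"
proof -
  have "(\<Prod>i = 0..<q. ((us @ f # vs) ! i) (p i)) =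
      f (p (length us)) * (\<Prod>i \<in> {0..<q} - {length us}. ((us @ (\<lambda>_. 0) # vs) ! i) (p i))" for p
  proof -
    have "(\<Prod>i = 0..<q. ((us @ f # vs) ! i) (p i)) = ((us @ f # vs) ! length us) (p (length us)) *
        (\<Prod>i \<in> {0..<q} - {length us}. ((us @ f # vs) ! i) (p i))"
      by (rule prod.remove) (use assms in auto)
    also have "(\<Prod>i \<in> {0..<q} - {length us}. ((us @ f # vs) ! i) (p i)) =
        (\<Prod>i \<in> {0..<q} - {length us}. ((us @ (\<lambda>_. 0) # vs) ! i) (p i))"
      by (rule prod.cong) (auto simp: nth_append nth_Cons split: nat.splits)
    finally show ?thesis by simp
  qed
  then show ?thesis
    by (simp add: row_det_Leibniz[OF assms])
qed

lemma row_det_add: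
  "row_det q (us @ (\<lambda>i. f i + g i) # vs) = row_det q (us @ f # vs) + row_det q (us @ g # vs)"
proof (cases "length (us @ f # vs) = q")
  case True
  then have "length (us @ h # vs) = q" for h :: "nat \<Rightarrow> real" by simp
  then show ?thesis
    by (simp only: row_det_split flip: sum.distrib) (simp add: algebra_simps)
qed (simp add: row_det_def)

lemma row_det_scale:
  "row_det q (us @ (\<lambda>i. c * f i) # vs) = c * row_det q (us @ f # vs)"
proof (cases "length (us @ f # vs) = q")
  case True
  then have "length (us @ h # vs) = q" for h :: "nat \<Rightarrow> real" by simp
  then show ?thesis
    by (simp only: row_det_split sum_distrib_left) (simp add: algebra_simps)
qed (simp add: row_det_def)

lemma row_det_diff:
  "row_det q (us @ (\<lambda>i. f i - g i) # vs) = row_det q (us @ f # vs) - row_det q (us @ g # vs)"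
  using row_det_add[of q us "\<lambda>i. f i - g i" g vs] by simp

lemma row_det_eq_0:
  assumes "i < length us" "j < length us" "i \<noteq> j" "us ! i = us ! j"
  shows "row_det q us = 0"
proof (cases "length us = q")
  case True
  have "det (mat q q (\<lambda>(i, j). (us ! i) j)) = 0"
    by (rule det_identical_rows[of _ q i j]) (use assms True in \<open>auto intro!: eq_vecI\<close>)
  then show ?thesis by (simp add: row_det_def)
qed (simp add: row_det_def)

lemma row_det_not_distinct: "\<not> distinct us \<Longrightarrow> row_det q us = 0"
  by (auto simp: distinct_conv_nth intro: row_det_eq_0)

text \<open>Every permutation meets column \<open>q\<close>. This settles odd rows with no dent and
  no removed triangle, where the weight is 0.\<close>

lemma row_det_last_column_0:
  assumes "\<forall>u\<in>set us. u q = 0"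
  shows "row_det (Suc q) us = 0"
proof (cases "length us = Suc q")
  case True
  have "\<exists>i\<in>{0..<Suc q}. (us ! i) (p i) = 0" if p: "p permutes {0..<Suc q}" for p
  proof -
    obtain i where "i < Suc q" "p i = q"
      using permutes_image[OF p] by (metis atLeastLessThan_iff imageE lessI zero_le)
    then show ?thesis using assms True by (intro bexI[of _ i]) auto
  qed
  then have "(\<Prod>i = 0..<Suc q. (us ! i) (p i)) = 0" if "p permutes {0..<Suc q}" for p
    using that by (intro prod_zero) auto
  then show ?thesis
    unfolding row_det_Leibniz[OF True] by (intro sum.neutral) auto
qed (simp add: row_det_def)

lemma row_det_snoc:
  assumes us: "\<forall>u\<in>set us. u q = 0" and f: "f q = 1"
  shows "row_det (Suc q) (us @ [f]) = row_det q us"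
proof (cases "length us = q")
  case True
  let ?A = "mat (Suc q) (Suc q) (\<lambda>(i, j). ((us @ [f]) ! i) j)"
  have "det ?A = (\<Sum>i<Suc q. ?A $$ (i, q) * cofactor ?A i q)"
    by (rule laplace_expansion_column) auto
  also have "\<dots> = cofactor ?A q q"
  proof -
    have "?A $$ (i, q) = 0" if "i < q" for i
      using us True that by (simp add: nth_append)
    moreover have "?A $$ (q, q) = 1"
      using f True nth_append_length[of us f "[]"] by simp
    ultimately show ?thesis by simp
  qed
  also have "\<dots> = det (mat_delete ?A q q)"
    by (simp add: cofactor_def)
  also have "mat_delete ?A q q = mat q q (\<lambda>(i, j). (us ! i) j)"
    using True by (auto simp: mat_delete_def nth_append intro!: eq_matI)
  finally show ?thesis using True by (simp add: row_det_def)
qed (simp add: row_det_def)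

text \<open>Such differences arise when rows are summed over the positions between consecutive
  entries: interlacing turns into telescoping.\<close>

fun successive_diffs :: "(real \<Rightarrow> nat \<Rightarrow> real) \<Rightarrow> real list \<Rightarrow> (nat \<Rightarrow> real) list" where
  "successive_diffs V (x # y # zs) = (\<lambda>i. V x i - V y i) # successive_diffs V (y # zs)"
| "successive_diffs V _ = []"

text \<open>The differences are undone from the right end: once the next row is \<open>V y\<close>,
  adding it to \<open>V x - V y\<close> leaves \<open>V x\<close>. The final 0 contributes
  nothing.\<close>

lemma row_det_successive_diffs_zero:
  assumes "V 0 = (\<lambda>_. 0)"
  shows "row_det q (us @ successive_diffs V (xs @ [0])) = row_det q (us @ map V xs)"
proof (induction xs arbitrary: us)
  case (Cons x xs)
  show ?case
  proof (cases xs)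
    case Nil
    then show ?thesis by (simp add: assms)
  next
    case (Cons y ys)
    let ?d = "\<lambda>i. V x i - V y i"
    have "row_det q (us @ successive_diffs V ((x # xs) @ [0])) =
        row_det q ((us @ [?d]) @ successive_diffs V (xs @ [0]))"
      by (simp add: Cons)
    also have "\<dots> = row_det q (us @ ?d # map V xs)"
      by (subst Cons.IH) simp
    also have "\<dots> = row_det q (us @ map V (x # xs)) - row_det q (us @ V y # V y # map V ys)"
      using Cons by (simp add: row_det_diff)
    also have "row_det q (us @ V y # V y # map V ys) = 0"
      by (rule row_det_not_distinct) simp
    finally show ?thesis by simp
  qed
qed simp

text \<open>Column \<open>q\<close> is 0 on \<open>us\<close> and 1 on all rows \<open>V x\<close>.
  Subtracting neighbours clears it except in the last row, and expansion along it lowers the size by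
  one.\<close>

lemma row_det_successive_diffs_extend:
  assumes "\<forall>u\<in>set us. u q = 0" and V: "\<And>x. V x q = 1" and "xs \<noteq> []"
  shows "row_det q (us @ successive_diffs V xs) = row_det (Suc q) (us @ map V xs)"
  using assms(1,3)
proof (induction xs arbitrary: us)
  case (Cons x xs)
  show ?case
  proof (cases xs)
    case Nil
    then show ?thesis using Cons.prems V by (simp add: row_det_snoc)
  next
    case (Cons y ys)
    let ?d = "\<lambda>i. V x i - V y i"
    have "row_det q (us @ successive_diffs V (x # xs)) =
        row_det q ((us @ [?d]) @ successive_diffs V xs)"
      by (simp add: Cons)
    also have "\<dots> = row_det (Suc q) ((us @ [?d]) @ map V xs)"
      by (rule Cons.IH) (use Cons.prems V Cons in auto)
    also have "\<dots> = row_det (Suc q) (us @ map V (x # xs)) -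
        row_det (Suc q) (us @ V y # V y # map V ys)"
      using Cons by (simp add: row_det_diff)
    also have "row_det (Suc q) (us @ V y # V y # map V ys) = 0"
      by (rule row_det_not_distinct) simp
    finally show ?thesis by simp
  qed
qed simp

section \<open>Central binomials and the rows built from them\<close>

definition central_binomial :: "nat \<Rightarrow> real \<Rightarrow> real" where
  "central_binomial k z = ((z + real k - 1) / 2) gchoose k"

lemma central_binomial_0 [simp]: "central_binomial 0 z = 1"
  by (simp add: central_binomial_def)

text \<open>Pascal's rule: halving turns the step 2 in \<open>z\<close> into a step 1 of the upper
  index.\<close>

lemma central_binomial_diff:
  "central_binomial (Suc k) (z + 1) - central_binomial (Suc k) (z - 1) = central_binomial k z"
proof -
  define r where "r = (z + real k - 1) / 2"
  have "(z + 1 + real (Suc k) - 1) / 2 = r + 1" "(z - 1 + real (Suc k) - 1) / 2 = r"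
    by (simp_all add: r_def field_simps)
  then show ?thesis
    using gbinomial_Suc_Suc[of r k] by (simp only: central_binomial_def flip: r_def)
qed

lemma central_binomial_minus: "central_binomial k (- z) = (- 1) ^ k * central_binomial k z"
proof -
  have "central_binomial k (- z) = (- 1) ^ k * (real k - (- z + real k - 1) / 2 - 1 gchoose k)"
    unfolding central_binomial_def by (rule gbinomial_negated_upper)
  also have "real k - (- z + real k - 1) / 2 - 1 = (z + real k - 1) / 2"
    by (simp add: field_simps)
  finally show ?thesis by (simp add: central_binomial_def)
qed

text \<open>
  The row contributed by an up-pointing triangle at position z of row j to the determinant for
  rows 1 to j; the guard replaces the central binomials of negative index by 0.
\<close>

definition boundary_row :: "nat \<Rightarrow> real \<Rightarrow> nat \<Rightarrow> real" where
  "boundary_row j z i = (if 2 * i < j then central_binomial (j - 1 - 2 * i) z else 0)"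

lemma boundary_row_diff:
  assumes "j \<ge> 1"
  shows "boundary_row j (z + 1) i - boundary_row j (z - 1) i = boundary_row (j - 1) z i"
proof -
  \<comment> \<open>In the middle case the left side is a difference of two constants 1, and the
    guard makes the right side 0.\<close>
  consider "j - 1 - 2 * i = Suc (j - 1 - 1 - 2 * i)" "2 * i < j - 1" | "2 * i = j - 1" | "2 * i \<ge> j"
    by linarith
  then show ?thesis
    using assms central_binomial_diff[of "j - 1 - 1 - 2 * i" z]
    by cases (auto simp: boundary_row_def)
qed

text \<open>For even \<open>j\<close> every index \<open>j - 1 - 2 * i\<close> in range is odd, so
  the entries are odd polynomials.\<close>

lemma boundary_row_minus:
  assumes "even j"
  shows "boundary_row j (- z) i = - boundary_row j z i"
proof (cases "2 * i < j")
  case True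
  then have "odd (j - 1 - 2 * i)" using assms by presburger
  then show ?thesis by (simp add: boundary_row_def central_binomial_minus)
qed (simp add: boundary_row_def)

lemma boundary_row_zero: "even j \<Longrightarrow> boundary_row j 0 = (\<lambda>_. 0)"
  using boundary_row_minus[of j 0] by (intro ext) simp

section \<open>Polynomial dependence on the position\<close>

lemma ex_poly_central_binomial: "\<exists>p. \<forall>x. poly p x = central_binomial k (x + c)"
proof -
  let ?p = "Polynomial.smult (1 / fact k) (\<Prod>i = 0..<k. [: (c + real k - 1) / 2 - real i, 1 / 2 :])"
  have "poly ?p x = central_binomial k (x + c)" for x
    by (simp add: central_binomial_def gbinomial_prod_rev poly_prod field_simps)
  then show ?thesis by blast
qed

lemma ex_poly_boundary_row: "\<exists>p. \<forall>x. poly p x = boundary_row j (x + c) i"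
proof (cases "2 * i < j")
  case True
  then show ?thesis using ex_poly_central_binomial by (simp add: boundary_row_def)
qed (auto simp: boundary_row_def intro: exI[of _ 0])

lemma ex_poly_row_det:
  assumes "\<And>j i. \<exists>p. \<forall>x. poly p x = g j x i"
  shows "\<exists>p. \<forall>x. poly p x = row_det q (map (\<lambda>j. g j x) js)"
proof (cases "length js = q")
  case True
  obtain P where P: "\<And>j i x. poly (P j i) x = g j x i"
    using assms by metis
  let ?p = "\<Sum>\<sigma> | \<sigma> permutes {0..<q}. Polynomial.smult (signof \<sigma>) (\<Prod>i = 0..<q. P (js ! i) (\<sigma> i))"
  have "poly ?p x = row_det q (map (\<lambda>j. g j x) js)" for x
    using True by (simp add: row_det_Leibniz poly_sum poly_prod P)
  then show ?thesis by blast
qed (auto simp: row_det_def intro: exI[of _ 0])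

subsection \<open>Lozenge tilings\<close>

lemma lozenge_pair_iff: "lozenge {s, t} \<longleftrightarrow> card (vertices s \<inter> vertices t) = 2"
  unfolding lozenge_def doubleton_eq_iff by (metis Int_commute)

lemma card_Int_of_three:
  assumes "a \<noteq> b" "a \<noteq> c" "b \<noteq> c"
  shows "card ({a, b, c} \<inter> B) = of_bool (a \<in> B) + of_bool (b \<in> B) + of_bool (c \<in> B)"
  using assms by (auto simp: Int_insert_left)

lemma mem_vertices_iff:
  "(x, y) \<in> vertices (i, j) \<longleftrightarrow>
    (if odd (i + j) then x = i \<and> y = j - 1 \<or> y = j \<and> (x = i - 1 \<or> x = i + 1)
     else x = i \<and> y = j \<or> y = j - 1 \<and> (x = i - 1 \<or> x = i + 1))"
  by auto

lemma of_bool_sum_eq_2: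
  "of_bool A + of_bool B + of_bool C = (2 :: nat) \<longleftrightarrow>
    A \<and> B \<and> \<not> C \<or> A \<and> \<not> B \<and> C \<or> \<not> A \<and> B \<and> C"
  by auto

text \<open>Sharing an edge means having exactly two common vertices. An up-pointing triangle has
  its horizontal edge below it, hence row \<open>j + 1\<close>; a down-pointing one has it
  above.\<close>

lemma lozenge_iff:
  "lozenge {(i, j), (k, l)} \<longleftrightarrow>
    l = j \<and> (k = i - 1 \<or> k = i + 1) \<or>
    k = i \<and> (if odd (i + j) then l = j + 1 else l = j - 1)"
proof (cases "odd (i + j)")
  case True
  have "card (vertices (i, j) \<inter> vertices (k, l)) =
      of_bool ((i, j - 1) \<in> vertices (k, l)) + of_bool ((i - 1, j) \<in> vertices (k, l)) +
      of_bool ((i + 1, j) \<in> vertices (k, l))"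
    using True by (simp add: card_Int_of_three del: Int_insert_left)
  then show ?thesis
    using True by (simp only: lozenge_pair_iff of_bool_sum_eq_2 mem_vertices_iff) presburger
next
  case False
  have "card (vertices (i, j) \<inter> vertices (k, l)) =
      of_bool ((i - 1, j - 1) \<in> vertices (k, l)) + of_bool ((i + 1, j - 1) \<in> vertices (k, l)) +
      of_bool ((i, j) \<in> vertices (k, l))"
    using False by (simp add: card_Int_of_three del: Int_insert_left)
  then show ?thesis
    using False by (simp only: lozenge_pair_iff of_bool_sum_eq_2 mem_vertices_iff) presburger
qed

lemma lozenge_tiling_insert:
  assumes "lozenge_tiling (R - {s, t}) T" "lozenge {s, t}" "s \<in> R" "t \<in> R"
  shows "lozenge_tiling R (insert {s, t} T)" "{s, t} \<notin> T"
proof -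
  have T: "\<forall>l\<in>T. lozenge l" "\<Union>T = R - {s, t}" "disjoint T" "{} \<notin> T"
    using assms(1) by (simp_all add: lozenge_tiling_def partition_on_def)
  moreover have "disjoint (insert {s, t} T)"
    using T(2,3) unfolding disjoint_def by blast
  ultimately show "lozenge_tiling R (insert {s, t} T)"
    using assms(2-4) by (simp add: lozenge_tiling_def partition_on_def) blast
  show "{s, t} \<notin> T"
    using T(2) by blast
qed

lemma lozenge_tiling_remove:
  assumes "lozenge_tiling R T" "{s, t} \<in> T"
  shows "lozenge_tiling (R - {s, t}) (T - {{s, t}})" "lozenge {s, t}" "s \<in> R" "t \<in> R"
proof -
  have T: "\<forall>l\<in>T. lozenge l" "\<Union>T = R" "disjoint T" "{} \<notin> T"
    using assms(1) by (simp_all add: lozenge_tiling_def partition_on_def)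
  have "\<Union> (T - {{s, t}}) = R - {s, t}"
  proof -
    have "l \<inter> {s, t} = {}" if "l \<in> T - {{s, t}}" for l
      using that T(3) assms(2) by (simp add: disjointD)
    then have "\<Union> (T - {{s, t}}) \<inter> {s, t} = {}" by blast
    moreover have "\<Union> (insert {s, t} (T - {{s, t}})) = R"
      using assms(2) T(2) by (simp add: insert_absorb)
    ultimately show ?thesis by blast
  qed
  moreover have "disjoint (T - {{s, t}})"
    using T(3) unfolding disjoint_def by blast
  ultimately show "lozenge_tiling (R - {s, t}) (T - {{s, t}})"
    using T by (simp add: lozenge_tiling_def partition_on_def)
  show "lozenge {s, t}" "s \<in> R" "t \<in> R"
    using T assms(2) by blast+
qed

lemma finite_lozenge_tilings: "finite R \<Longrightarrow> finite {T. lozenge_tiling R T}"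
  by (rule finite_subset[of _ "Pow (Pow R)"]) (auto simp: lozenge_tiling_def partition_on_def)

lemma finite_lozenge_tiling: "finite R \<Longrightarrow> lozenge_tiling R T \<Longrightarrow> finite T"
  by (rule finite_subset[of _ "Pow R"]) (auto simp: lozenge_tiling_def partition_on_def)

text \<open>Each tiling contains exactly one lozenge covering \<open>s\<close>; sorting the tilings
  by its other triangle \<open>t\<close> gives a disjoint union.\<close>

lemma weighted_tilings_expand:
  assumes R: "finite R" and s: "s \<in> R"
  shows "weighted_tilings w R =
    (\<Sum>t | t \<in> R \<and> lozenge {s, t}. w {s, t} * weighted_tilings w (R - {s, t}))"
proof -
  let ?N = "{t. t \<in> R \<and> lozenge {s, t}}"
  let ?B = "\<lambda>t. insert {s, t} ` {T. lozenge_tiling (R - {s, t}) T}"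
  have tilings: "{T. lozenge_tiling R T} = (\<Union>t\<in>?N. ?B t)"
  proof (intro equalityI subsetI)
    fix T assume "T \<in> {T. lozenge_tiling R T}"
    then have T: "lozenge_tiling R T" by simp
    then obtain l where l: "l \<in> T" "s \<in> l" "lozenge l"
      using s unfolding lozenge_tiling_def partition_on_def by blast
    then obtain t where t: "l = {s, t}" unfolding lozenge_def by blast
    then have "T = insert {s, t} (T - {{s, t}})" using l by blast
    then show "T \<in> (\<Union>t\<in>?N. ?B t)"
      using lozenge_tiling_remove[OF T, of s t] l t by blast
  qed (use s lozenge_tiling_insert(1) in blast)
  have disj: "?B t \<inter> ?B t' = {}" if "t \<in> ?N" "t' \<in> ?N" "t \<noteq> t'" for t t'
  proof (rule ccontr)
    assume "?B t \<inter> ?B t' \<noteq> {}"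
    then obtain T T' where T: "lozenge_tiling (R - {s, t}) T" "lozenge_tiling (R - {s, t'}) T'"
      "insert {s, t} T = insert {s, t'} T'" by blast
    then have "{s, t'} \<in> T" using that(3) by (metis doubleton_eq_iff insertE insertI1)
    then show False using T(1) unfolding lozenge_tiling_def partition_on_def by blast
  qed
  have step: "(\<Sum>T\<in>?B t. \<Prod>l\<in>T. w l) = w {s, t} * weighted_tilings w (R - {s, t})"
    if t: "t \<in> ?N" for t
  proof -
    have notin: "{s, t} \<notin> T" if "lozenge_tiling (R - {s, t}) T" for T
      using lozenge_tiling_insert(2)[OF that] t s by blast
    then have "inj_on (insert {s, t}) {T. lozenge_tiling (R - {s, t}) T}"
      by (auto simp: inj_on_def insert_ident)
    moreover have "(\<Prod>l\<in>insert {s, t} T. w l) = w {s, t} * (\<Prod>l\<in>T. w l)"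
      if "lozenge_tiling (R - {s, t}) T" for T
      using notin[OF that] finite_lozenge_tiling[OF _ that] R by simp
    ultimately show ?thesis
      by (simp add: sum.reindex weighted_tilings_def sum_distrib_left)
  qed
  have "weighted_tilings w R = (\<Sum>t\<in>?N. \<Sum>T\<in>?B t. \<Prod>l\<in>T. w l)"
    unfolding weighted_tilings_def tilings
    by (rule sum.UNION_disjoint) (use R disj in \<open>auto intro!: finite_lozenge_tilings\<close>)
  also have "\<dots> = (\<Sum>t\<in>?N. w {s, t} * weighted_tilings w (R - {s, t}))"
    by (rule sum.cong[OF refl step])
  finally show ?thesis .
qed

lemma weighted_tilings_empty [simp]: "weighted_tilings w {} = 1"
proof -
  have "{T. lozenge_tiling {} T} = {{}}"
    by (auto simp: lozenge_tiling_def partition_on_def)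
  then show ?thesis by (simp add: weighted_tilings_def)
qed

lemma axis_weight_horizontal: "axis_weight a {(i, j), (i + 1, j)} = 1"
  by (simp add: axis_weight_def)

lemma axis_weight_vertical:
  assumes "odd (i + j)"
  shows "axis_weight a {(i, j), (i, j + 1)} = (if i = 2 * int a then 1 / 2 else 1)"
proof -
  have "vertices (i, j) \<inter> vertices (i, j + 1) = {(i - 1, j), (i + 1, j)}"
    using assms by auto
  then have "vertical_lozenge {(i, j), (i, j + 1)}"
    unfolding vertical_lozenge_def
    by (intro exI[of _ "(i, j)"] exI[of _ "(i, j + 1)"] exI[of _ "(i - 1, j)"]
      exI[of _ "(i + 1, j)"]) simp
  then show ?thesis by (simp add: axis_weight_def)
qed

subsection \<open>Rows of the half hexagon\<close>

text \<open>
  Row j of the half hexagon consists of the \<^term>\<open>2 * a + row_length b n u j\<close> triangles next to the axis.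
  Below the western corner the rows shrink just as if there were a dent in each of them.
\<close>

definition row_length :: "nat \<Rightarrow> nat \<Rightarrow> (nat \<Rightarrow> nat) \<Rightarrow> nat \<Rightarrow> nat" where
  "row_length b n u j =
     (if j \<le> b + 2 * n then if j \<in> u ` {1..n} then j - 1 else j else 2 * b + 4 * n + 1 - j)"

lemma V_plus_eq:
  assumes u: "\<forall>i\<in>{1..n}. 1 \<le> u i \<and> u i \<le> b + 2 * n"
  shows "V_plus a b n u =
    {(2 * int a - int d, int j) | d j.
       1 \<le> j \<and> j \<le> 2 * b + 2 * n \<and> d < 2 * a + row_length b n u j}" (is "_ = ?R")
proof (intro Set.set_eqI)
  fix s :: tri
  obtain i y where s: "s = (i, y)" by (cases s)
  have dents: "s \<in> (\<lambda>k. nw_triangle (u k)) ` {1..n} \<longleftrightarrow> nat y \<in> u ` {1..n} \<and> y \<ge> 1 \<and> i = 1 - y"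
  proof
    assume "s \<in> (\<lambda>k. nw_triangle (u k)) ` {1..n}"
    then obtain k where "k \<in> {1..n}" "i = 1 - int (u k)" "y = int (u k)"
      by (auto simp: s nw_triangle_def)
    then show "nat y \<in> u ` {1..n} \<and> y \<ge> 1 \<and> i = 1 - y"
      using u by fastforce
  next
    assume *: "nat y \<in> u ` {1..n} \<and> y \<ge> 1 \<and> i = 1 - y"
    then obtain k where "k \<in> {1..n}" "nat y = u k" by blast
    moreover from this * have "s = nw_triangle (u k)" by (simp add: s nw_triangle_def flip: \<open>nat y = u k\<close>)
    ultimately show "s \<in> (\<lambda>k. nw_triangle (u k)) ` {1..n}" by blast
  qed
  \<comment> \<open>A northeast dent lies weakly west of the axis only for \<open>a = 0\<close> and
    \<open>u k = 1\<close>, and then it is also a northwest dent.\<close>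
  have ne: "s \<in> (\<lambda>k. nw_triangle (u k)) ` {1..n}"
    if west: "i \<le> 2 * int a" and "s \<in> (\<lambda>k. ne_triangle (2 * a) (u k)) ` {1..n}"
  proof -
    from that(2) obtain k where k: "k \<in> {1..n}" "i = 4 * int a + int (u k) - 1" "y = int (u k)"
      by (auto simp: s ne_triangle_def)
    then have "a = 0" "u k = 1" using u west by force+
    then have "s = nw_triangle (u k)" using k by (simp add: s nw_triangle_def)
    then show ?thesis using k(1) by blast
  qed
  have hex: "s \<in> hexagon (2 * a) b b (2 * n) \<and> i \<le> 2 * int a \<longleftrightarrow>
      1 \<le> y \<and> y \<le> 2 * int b + 2 * int n \<and> i \<le> 2 * int a \<and>
      (if y \<le> int b + 2 * int n then 1 - y \<le> i else y - 2 * int b - 4 * int n \<le> i)"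
  proof (cases "even (i + y)")
    case True
    \<comment> \<open>The parity is built into \<open>i\<close>, since the vertex inequalities
      determine the bounds on \<open>i\<close> only together with it.\<close>
    then obtain m where "i = 2 * m - y" by (metis add_diff_cancel_right' evenE)
    then show ?thesis using True by (simp add: s hexagon_def) (intro conjI impI iffI; elim conjE; (linarith | presburger))
  next
    case False
    then obtain m where "i = 2 * m + 1 - y" by (metis add_diff_cancel_right' oddE)
    then show ?thesis using False by (simp add: s hexagon_def) (intro conjI impI iffI; elim conjE; (linarith | presburger))
  qed
  show "s \<in> V_plus a b n u \<longleftrightarrow> s \<in> ?R"
  proof (cases "1 \<le> y \<and> y \<le> 2 * int b + 2 * int n \<and> i \<le> 2 * int a")
    case True
    define d j where "d = nat (2 * int a - i)" and "j = nat y"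
    then have dj: "i = 2 * int a - int d" "y = int j"
      using True by auto
    have "s \<in> ?R \<longleftrightarrow> d < 2 * a + row_length b n u j"
      using True by (auto simp: s dj)
    moreover have "s \<in> V_plus a b n u \<longleftrightarrow> d < 2 * a + row_length b n u j"
      using True hex ne dents
      by (auto simp: V_plus_def dented_hexagon_def s dj row_length_def split: if_splits)
    ultimately show ?thesis by simp
  next
    case False
    then show ?thesis
      using hex by (auto simp: V_plus_def dented_hexagon_def s)
  qed
qed

text \<open>This bound ensures that a down-pointing triangle with nothing above it sits at the end
  of a dented row; see \<open>row_value_dent\<close>.\<close>

lemma row_length_le:
  assumes "2 \<le> j"
  shows "row_length b n u j \<le>
    row_length b n u (j - 1) + (if even (row_length b n u j + j) then 2 else 1)"
  using assms by (auto simp: row_length_def)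

subsection \<open>Tilings of half strips\<close>

text \<open>
  Row j has \<open>2 a + c j\<close> triangles, and it counts as dented, i.e. its leftmost triangle points down,
  iff \<open>c j + j\<close> is odd. \<open>\<delta> = 1\<close> is the unweighted model, \<open>\<delta> = 0\<close> the one with weight 1/2 on the axis.
\<close>

locale half_strip =
  fixes a :: nat and c :: "nat \<Rightarrow> nat" and \<delta> :: real and w :: "tri set \<Rightarrow> real"
  assumes c_le: "2 \<le> j \<Longrightarrow> c j \<le> c (j - 1) + (if even (c j + j) then 2 else 1)"
    and \<delta>: "\<delta> = 0 \<or> \<delta> = 1"
    and w_horizontal: "w {(i, k), (i + 1, k)} = 1"
    and w_vertical:
      "odd (i + k) \<Longrightarrow> w {(i, k), (i, k + 1)} = (if i = 2 * int a \<and> \<delta> = 0 then 1 / 2 else 1)"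
begin

definition tri_at :: "nat \<Rightarrow> nat \<Rightarrow> tri" where
  "tri_at d j = (2 * int a - int d, int j)"

text \<open>Row 0 is empty, so no vertical lozenge enters row 1 and the induction can start at row
  0.\<close>

definition len :: "nat \<Rightarrow> nat" where
  "len j = (if j = 0 then 0 else 2 * a + c j)"

definition pos :: "nat \<Rightarrow> real" where
  "pos d = real d + \<delta>"

text \<open>
  The rows above row J without the up-pointing triangles \<^term>\<open>ys\<close> of the last one of them (they
  are covered by vertical lozenges reaching into row J), together with the e triangles of row J
  next to the axis, without \<^term>\<open>xs\<close>.
\<close>

definition partial_strip :: "nat \<Rightarrow> nat \<Rightarrow> nat list \<Rightarrow> nat list \<Rightarrow> tri set" where
  "partial_strip J e ys xs = {tri_at d j | d j.
     1 \<le> j \<and> j < J \<and> d < len j \<and> \<not> (j = J - 1 \<and> d \<in> set ys) \<or> j = J \<and> d < e \<and> d \<notin> set xs}"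

definition dents :: "nat \<Rightarrow> nat list" where
  "dents J = filter (\<lambda>j. odd (c j + j)) [1..<Suc J]"

definition dent_rows :: "nat \<Rightarrow> (nat \<Rightarrow> real) list" where
  "dent_rows J = map (\<lambda>j. boundary_row j (pos (len j))) (dents J)"

section \<open>Peeling triangles off a partial strip\<close>

lemma tri_at_eq_iff [simp]: "tri_at d j = tri_at d' j' \<longleftrightarrow> d = d' \<and> j = j'"
  by (auto simp: tri_at_def)

lemma lozenge_tri_at_iff:
  "lozenge {tri_at d j, tri_at d' j'} \<longleftrightarrow>
    j' = j \<and> (d' = d + 1 \<or> d = d' + 1) \<or> d' = d \<and> (if odd (d + j) then j' = j + 1 else j = j' + 1)"
  unfolding tri_at_def lozenge_iff by auto

lemma tri_at_mem_partial_strip: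
  "tri_at d j \<in> partial_strip J e ys xs \<longleftrightarrow>
    1 \<le> j \<and> j < J \<and> d < len j \<and> \<not> (j = J - 1 \<and> d \<in> set ys) \<or> j = J \<and> d < e \<and> d \<notin> set xs"
  by (auto simp: partial_strip_def)

lemma ex_tri_at:
  assumes "t \<in> partial_strip J e ys xs"
  shows "\<exists>d j. t = tri_at d j"
  using assms by (auto simp: partial_strip_def)

lemma partial_strip_eqI:
  assumes "\<And>t. t \<in> R \<Longrightarrow> \<exists>d j. t = tri_at d j"
    and "\<And>d j. tri_at d j \<in> R \<longleftrightarrow> tri_at d j \<in> partial_strip J e ys xs"
  shows "R = partial_strip J e ys xs"
  using assms ex_tri_at by (metis subsetI subset_antisym)

lemma finite_partial_strip [simp]: "finite (partial_strip J e ys xs)"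
proof -
  have "partial_strip J e ys xs \<subseteq>
      (\<lambda>(d, j). tri_at d j) ` ((\<Union>j\<in>{..J}. {..<len j} \<times> {j}) \<union> {..<e} \<times> {J})"
  proof
    fix t assume t: "t \<in> partial_strip J e ys xs"
    then obtain d j where "t = tri_at d j" by (blast dest: ex_tri_at)
    then show "t \<in> (\<lambda>(d, j). tri_at d j) ` ((\<Union>j\<in>{..J}. {..<len j} \<times> {j}) \<union> {..<e} \<times> {J})"
      using t by (intro image_eqI[of _ _ "(d, j)"]) (auto simp: tri_at_mem_partial_strip)
  qed
  then show ?thesis by (rule finite_subset) auto
qed

text \<open>When row \<open>J\<close> is used up, \<open>ys\<close> becomes the removed set of row
  \<open>J - 1\<close>; this links the induction along a row to the one over rows.\<close>

lemma partial_strip_0: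
  assumes "J \<ge> 1"
  shows "partial_strip J 0 ys [] = partial_strip (J - 1) (len (J - 1)) [] ys"
proof (rule partial_strip_eqI)
  fix d j
  show "tri_at d j \<in> partial_strip J 0 ys [] \<longleftrightarrow>
      tri_at d j \<in> partial_strip (J - 1) (len (J - 1)) [] ys"
    using assms by (cases "j = J - 1") (auto simp: tri_at_mem_partial_strip len_def)
qed (blast dest: ex_tri_at)

lemma partial_strip_removed: "partial_strip J (Suc m) ys (m # xs) = partial_strip J m ys xs"
proof (rule partial_strip_eqI)
  fix d j
  show "tri_at d j \<in> partial_strip J (Suc m) ys (m # xs) \<longleftrightarrow> tri_at d j \<in> partial_strip J m ys xs"
    by (auto simp: tri_at_mem_partial_strip)
qed (blast dest: ex_tri_at)

lemma partial_strip_horizontal: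
  "partial_strip J (Suc (Suc k)) ys xs - {tri_at (Suc k) J, tri_at k J} = partial_strip J k ys xs"
proof (rule partial_strip_eqI)
  fix d j
  show "tri_at d j \<in> partial_strip J (Suc (Suc k)) ys xs - {tri_at (Suc k) J, tri_at k J} \<longleftrightarrow>
      tri_at d j \<in> partial_strip J k ys xs"
    by (auto simp: tri_at_mem_partial_strip)
qed (blast dest: ex_tri_at)

lemma partial_strip_vertical:
  assumes "J \<ge> 1"
  shows "partial_strip J (Suc m) ys xs - {tri_at m J, tri_at m (J - 1)} =
    partial_strip J m (ys @ [m]) xs"
proof (rule partial_strip_eqI)
  fix d j
  show "tri_at d j \<in> partial_strip J (Suc m) ys xs - {tri_at m J, tri_at m (J - 1)} \<longleftrightarrow>
      tri_at d j \<in> partial_strip J m (ys @ [m]) xs"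
    using assms by (auto simp: tri_at_mem_partial_strip)
qed (blast dest: ex_tri_at)

section \<open>Recursion on the leftmost triangle of the last row\<close>

abbreviation weight :: "tri set \<Rightarrow> real" where
  "weight \<equiv> weighted_tilings w"

lemma weight_expand:
  assumes "tri_at m J \<in> partial_strip J e ys xs"
    and "\<And>d j. tri_at d j \<in> partial_strip J e ys xs \<and> lozenge {tri_at m J, tri_at d j} \<longleftrightarrow>
      tri_at d j \<in> N"
    and "\<And>t. t \<in> N \<Longrightarrow> \<exists>d j. t = tri_at d j"
  shows "weight (partial_strip J e ys xs) =
    (\<Sum>t\<in>N. w {tri_at m J, t} * weight (partial_strip J e ys xs - {tri_at m J, t}))"
proof -
  have "{t. t \<in> partial_strip J e ys xs \<and> lozenge {tri_at m J, t}} = N"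
  proof (intro Set.set_eqI)
    fix t
    show "t \<in> {t. t \<in> partial_strip J e ys xs \<and> lozenge {tri_at m J, t}} \<longleftrightarrow> t \<in> N"
      using assms(2) assms(3)[of t] ex_tri_at[of t J e ys xs] unfolding mem_Collect_eq by metis
  qed
  then show ?thesis
    using weighted_tilings_expand[OF finite_partial_strip assms(1), of w] by simp
qed

lemma w_horizontal_tri_at: "w {tri_at (Suc k) j, tri_at k j} = 1"
  using w_horizontal[of "2 * int a - int (Suc k)" "int j"] by (simp add: tri_at_def)

lemma w_vertical_tri_at:
  assumes "even (m + J)" "J \<ge> 1"
  shows "w {tri_at m J, tri_at m (J - 1)} = (if m = 0 \<and> \<delta> = 0 then 1 / 2 else 1)"
proof -
  have "odd (2 * int a - int m + int (J - 1))" using assms by simp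
  from w_vertical[OF this] show ?thesis
    using assms by (simp add: tri_at_def insert_commute)
qed

text \<open>The remaining triangle on the axis points up, and all its possible partners lie outside
  the region.\<close>

lemma weight_up_0:
  assumes "odd J" "0 \<notin> set xs"
  shows "weight (partial_strip J (Suc 0) ys xs) = 0"
  by (subst weight_expand[where N = "{}"])
    (use assms in \<open>auto simp: tri_at_mem_partial_strip lozenge_tri_at_iff\<close>)

text \<open>An up-pointing leftmost triangle can only be paired with its eastern neighbour, as the
  row below is absent.\<close>

lemma weight_up:
  assumes "even (k + J)" "\<forall>x\<in>set xs. odd (x + J)" "Suc k \<notin> set xs"
  shows "weight (partial_strip J (Suc (Suc k)) ys xs) = weight (partial_strip J k ys xs)"
proof -
  have "k \<notin> set xs" using assms by blast
  then have "weight (partial_strip J (Suc (Suc k)) ys xs) =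
      (\<Sum>t\<in>{tri_at k J}. w {tri_at (Suc k) J, t} *
        weight (partial_strip J (Suc (Suc k)) ys xs - {tri_at (Suc k) J, t}))"
    by (intro weight_expand)
      (use assms(1,3) in \<open>auto simp: tri_at_mem_partial_strip lozenge_tri_at_iff\<close>)
  then show ?thesis
    by (simp add: w_horizontal_tri_at partial_strip_horizontal)
qed

text \<open>A down-pointing leftmost triangle pairs with its eastern neighbour or with the triangle
  above. Positions are met in decreasing order, so \<open>m\<close> is appended to
  \<open>ys\<close>.\<close>

lemma weight_down:
  assumes J: "J \<ge> 1" and m: "even (m + J)" "\<forall>y\<in>set ys. m < y" "\<forall>x\<in>set xs. odd (x + J)"
  shows "weight (partial_strip J (Suc m) ys xs) =
    (if m = 0 \<or> m - 1 \<in> set xs then 0 else weight (partial_strip J (m - 1) ys xs)) +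
    (if m < len (J - 1) then
       (if m = 0 \<and> \<delta> = 0 then 1 / 2 else 1) * weight (partial_strip J m (ys @ [m]) xs) else 0)"
proof -
  define H where "H = (if m = 0 \<or> m - 1 \<in> set xs then {} else {tri_at (m - 1) J})"
  define U where "U = (if m < len (J - 1) then {tri_at m (J - 1)} else {})"
  let ?f = "\<lambda>t. w {tri_at m J, t} * weight (partial_strip J (Suc m) ys xs - {tri_at m J, t})"
  have "m \<notin> set ys" "m \<notin> set xs" using m by auto
  have "weight (partial_strip J (Suc m) ys xs) = sum ?f (H \<union> U)"
  proof (rule weight_expand)
    show "tri_at m J \<in> partial_strip J (Suc m) ys xs"
      using \<open>m \<notin> set xs\<close> by (simp add: tri_at_mem_partial_strip)
    show "\<exists>d j. t = tri_at d j" if "t \<in> H \<union> U" for t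
      using that by (auto simp: H_def U_def split: if_splits)
    fix d j
    have lozenge: "lozenge {tri_at m J, tri_at d j} \<longleftrightarrow>
        j = J \<and> (d = m + 1 \<or> m = d + 1) \<or> d = m \<and> J = j + 1"
      using m(1) by (simp add: lozenge_tri_at_iff)
    have H: "tri_at d j \<in> H \<longleftrightarrow> j = J \<and> m = d + 1 \<and> d \<notin> set xs"
      by (auto simp: H_def)
    have U: "tri_at d j \<in> U \<longleftrightarrow> d = m \<and> J = j + 1 \<and> m < len j"
      using J by (auto simp: U_def)
    show "tri_at d j \<in> partial_strip J (Suc m) ys xs \<and> lozenge {tri_at m J, tri_at d j} \<longleftrightarrow>
        tri_at d j \<in> H \<union> U"
      unfolding lozenge Un_iff H U tri_at_mem_partial_strip
      using \<open>m \<notin> set ys\<close> by (cases "j = 0") (auto simp: len_def)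
  qed
  also have "\<dots> = sum ?f H + sum ?f U"
    by (rule sum.union_disjoint) (use J in \<open>auto simp: H_def U_def\<close>)
  also have "sum ?f H = (if m = 0 \<or> m - 1 \<in> set xs then 0 else weight (partial_strip J (m - 1) ys xs))"
    using w_horizontal_tri_at[of "m - 1" J] partial_strip_horizontal[of J "m - 1" ys xs]
    by (cases m) (auto simp: H_def)
  also have "sum ?f U = (if m < len (J - 1) then
      (if m = 0 \<and> \<delta> = 0 then 1 / 2 else 1) * weight (partial_strip J m (ys @ [m]) xs) else 0)"
    using w_vertical_tri_at[OF m(1) J] partial_strip_vertical[OF J] by (simp add: U_def)
  finally show ?thesis .
qed

text \<open>
  In an even row the triangle on the axis points down, so its last interval of positions is not
  bounded by an up-pointing triangle; 0 serves as its lower end, as \<^term>\<open>boundary_row J\<close> vanishes there.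
\<close>

definition row_end :: "nat \<Rightarrow> real list" where
  "row_end J = (if even J then [0] else [])"

text \<open>With \<open>us = []\<close> this is the formula for row \<open>J - 1\<close> with
  \<open>ys\<close> removed; \<open>us\<close> holds the rows that already account for the vertical
  lozenges still to be chosen.\<close>

definition row_value :: "nat \<Rightarrow> nat list \<Rightarrow> (nat \<Rightarrow> real) list \<Rightarrow> real" where
  "row_value J ys us =
    row_det (J div 2) (dent_rows (J - 1) @ map (\<lambda>y. boundary_row (J - 1) (pos y)) ys @ us)"

lemma row_value_snoc:
  "row_value J (ys @ [m]) us = row_value J ys (boundary_row (J - 1) (pos m) # us)"
  by (simp add: row_value_def)

lemma row_value_add:
  "row_value J ys ((\<lambda>i. f i + g i) # us) = row_value J ys (f # us) + row_value J ys (g # us)"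
  unfolding row_value_def
  using row_det_add[of "J div 2" "dent_rows (J - 1) @ map (\<lambda>y. boundary_row (J - 1) (pos y)) ys" f g us]
  by simp

lemma row_value_scale:
  "row_value J ys ((\<lambda>i. r * f i) # us) = r * row_value J ys (f # us)"
  unfolding row_value_def
  using row_det_scale[of "J div 2" "dent_rows (J - 1) @ map (\<lambda>y. boundary_row (J - 1) (pos y)) ys" r f us]
  by simp

text \<open>A position just beyond the row above is the dent of that row, so its row occurs twice.
  Hence the determinant itself discards the impossible vertical lozenge.\<close>

lemma row_value_dent:
  assumes J: "J \<ge> 1" and m: "even (m + J)" "m < len J" "\<not> m < len (J - 1)"
  shows "row_value J ys (boundary_row (J - 1) (pos m) # us) = 0"
proof (cases "J = 1")
  case True
  then show ?thesis by (simp add: row_value_def row_det_def)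
next
  case False
  have "m < 2 * a + c J" "2 * a + c (J - 1) \<le> m"
    using m J False by (simp_all add: len_def)
  \<comment> \<open>If \<open>c J + J\<close> is even, parity gives
    \<open>m \<le> len J - 2\<close>, otherwise \<open>m \<le> len J - 1\<close>; both match
    \<open>c_le\<close>.\<close>
  then have "m = 2 * a + c (J - 1)"
    using c_le[of J] J False m(1) by (cases "even (c J + J)") (simp_all, presburger)
  then have "m = len (J - 1)" "odd (c (J - 1) + (J - 1))"
    using m(1) J False by (simp_all add: len_def)
  then have "boundary_row (J - 1) (pos m) \<in> set (dent_rows (J - 1))"
    using J False by (auto simp: dent_rows_def dents_def)
  then show ?thesis
    unfolding row_value_def by (intro row_det_not_distinct) auto
qed

lemma boundary_row_pos_diff:
  assumes "J \<ge> 1" "m \<ge> 1"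
  shows "boundary_row J (pos (Suc m)) i =
    boundary_row (J - 1) (pos m) i + boundary_row J (pos (m - 1)) i"
proof -
  have "pos (Suc m) = pos m + 1" "pos (m - 1) = pos m - 1"
    using assms(2) by (simp_all add: pos_def of_nat_diff)
  then show ?thesis using boundary_row_diff[OF assms(1), of "pos m" i] by simp
qed

text \<open>
  The only place where the two models differ: for \<^term>\<open>\<delta> = 0\<close> the weight 1/2 on the axis matches
  the oddness of \<^term>\<open>boundary_row J\<close>, for \<^term>\<open>\<delta> = 1\<close> its vanishing at 0 suffices.
\<close>

lemma boundary_row_pos_1:
  assumes "J \<ge> 1" "even J"
  shows "boundary_row J (pos 1) i =
    (if \<delta> = 0 then 1 / 2 else 1) * boundary_row (J - 1) (pos 0) i"
proof -
  have pos: "pos 1 = 1 + \<delta>" "pos 0 = \<delta>" by (simp_all add: pos_def)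
  from \<delta> show ?thesis
  proof
    assume "\<delta> = 0"
    then show ?thesis
      using boundary_row_diff[OF assms(1), of 0 i] boundary_row_minus[OF assms(2), of 1 i]
      unfolding pos by simp
  next
    assume "\<delta> = 1"
    then show ?thesis
      using boundary_row_diff[OF assms(1), of 1 i] boundary_row_zero[OF assms(2)]
      unfolding pos by simp
  qed
qed

text \<open>The determinant counterpart of \<open>weight_down\<close>: the first difference splits
  into the row at \<open>m\<close> (vertical lozenge) and the difference starting at
  \<open>m - 1\<close> (horizontal lozenge).\<close>

lemma row_value_down:
  assumes J: "J \<ge> 1" and m: "even (m + J)"
    and xs: "sorted_wrt (>) xs" "\<forall>x\<in>set xs. x < Suc m \<and> odd (x + J)"
  defines "zs \<equiv> map pos xs @ row_end J"
  shows "row_value J ys (successive_diffs (boundary_row J) (pos (Suc m) # zs)) =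
    (if m = 0 \<or> m - 1 \<in> set xs then 0
     else row_value J ys (successive_diffs (boundary_row J) (pos (m - 1) # zs))) +
    (if zs = [] then 0 else (if m = 0 \<and> \<delta> = 0 then 1 / 2 else 1) *
      row_value J ys (boundary_row (J - 1) (pos m) # successive_diffs (boundary_row J) zs))"
proof (cases zs)
  case Nil
  then have "xs = []" "odd J" by (auto simp: zs_def row_end_def split: if_splits)
  then have "m \<noteq> 0" using m by (cases m) auto
  then show ?thesis using Nil \<open>xs = []\<close> by simp
next
  case zs: (Cons z zs')
  let ?V = "boundary_row J"
  let ?v = "boundary_row (J - 1) (pos m)"
  let ?D = "successive_diffs ?V zs"
  have expand: "successive_diffs ?V (x # zs) = (\<lambda>i. ?V x i - ?V z i) # ?D" for x
    by (simp add: zs)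
  consider "m = 0" | "m \<ge> 1" "m - 1 \<in> set xs" | "m \<ge> 1" "m - 1 \<notin> set xs" by linarith
  then show ?thesis
  proof cases
    case 1
    have "xs = []"
    proof (rule ccontr)
      assume "xs \<noteq> []"
      then obtain x where "x \<in> set xs" by (cases xs) auto
      then have "x = 0" "odd (x + J)" using xs(2) 1 by fastforce+
      then show False using m 1 by simp
    qed
    moreover have "even J" using m 1 by simp
    ultimately have "z = 0" using zs by (simp add: zs_def row_end_def)
    then have eq: "(\<lambda>i. ?V (pos (Suc m)) i - ?V z i) = (\<lambda>i. (if \<delta> = 0 then 1 / 2 else 1) * ?v i)"
      using boundary_row_pos_1[OF J \<open>even J\<close>] boundary_row_zero[OF \<open>even J\<close>] 1 by simp
    have "row_value J ys (successive_diffs ?V (pos (Suc m) # zs)) =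
        (if \<delta> = 0 then 1 / 2 else 1) * row_value J ys (?v # ?D)"
      unfolding expand eq by (rule row_value_scale)
    then show ?thesis using 1 zs by simp
  next
    case 2
    then obtain x xs' where x: "xs = x # xs'" by (cases xs) auto
    \<comment> \<open>The list decreases and parity excludes \<open>m\<close>, so the entry
      \<open>m - 1\<close> is its head.\<close>
    have "x = m - 1"
    proof (rule ccontr)
      assume "x \<noteq> m - 1"
      then have "m - 1 < x" using 2 xs(1) x by auto
      moreover have "x < Suc m" "odd (x + J)" using xs(2) x by simp_all
      ultimately have "x = m" by simp
      then show False using m \<open>odd (x + J)\<close> by simp
    qed
    then have "z = pos (m - 1)" using zs x by (simp add: zs_def)
    then have "(\<lambda>i. ?V (pos (Suc m)) i - ?V z i) = ?v"
      using boundary_row_pos_diff[OF J 2(1)] by simp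
    then show ?thesis
      using 2 zs by (simp add: expand)
  next
    case 3
    have eq: "(\<lambda>i. ?V (pos (Suc m)) i - ?V z i) = (\<lambda>i. ?v i + (?V (pos (m - 1)) i - ?V z i))"
      using boundary_row_pos_diff[OF J 3(1)] by (simp add: add_diff_eq)
    have "row_value J ys (successive_diffs ?V (pos (Suc m) # zs)) =
        row_value J ys (?v # ?D) + row_value J ys (successive_diffs ?V (pos (m - 1) # zs))"
      unfolding expand eq by (rule row_value_add)
    then show ?thesis using 3 zs by simp
  qed
qed

text \<open>
  The leftmost remaining triangle of row J points down iff \<^term>\<open>e + J\<close> is odd. Then \<^term>\<open>e\<close> itself acts
  as a removed up-pointing triangle; otherwise all lozenges up to the next removed one are forced.
\<close>

definition row_result :: "nat \<Rightarrow> nat \<Rightarrow> nat list \<Rightarrow> nat list \<Rightarrow> real" where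
  "row_result J e ys xs = (let zs = map pos xs @ row_end J in
    if odd (e + J) then row_value J ys (successive_diffs (boundary_row J) (pos e # zs))
    else if zs = [] then 0 else row_value J ys (successive_diffs (boundary_row J) zs))"

lemma row_result_odd:
  "odd (e + J) \<Longrightarrow> row_result J e ys xs =
    row_value J ys (successive_diffs (boundary_row J) (pos e # map pos xs @ row_end J))"
  by (simp add: row_result_def Let_def)

lemma row_result_even:
  "even (e + J) \<Longrightarrow> row_result J e ys xs =
    (if map pos xs @ row_end J = [] then 0
     else row_value J ys (successive_diffs (boundary_row J) (map pos xs @ row_end J)))"
  by (simp add: row_result_def Let_def)

text \<open>Row \<open>J\<close> is consumed from the west, by induction on \<open>e\<close>; at
  \<open>e = 0\<close> the formula for the previous row takes over.\<close>

lemma weight_partial_strip: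
  assumes J: "J \<ge> 1"
    and IH: "\<And>ys. sorted_wrt (>) ys \<Longrightarrow> \<forall>y\<in>set ys. y < len (J - 1) \<and> even (y + J) \<Longrightarrow>
      weight (partial_strip J 0 ys []) = row_value J ys []"
  assumes "e \<le> len J"
    and "sorted_wrt (>) ys" "\<forall>y\<in>set ys. e \<le> y \<and> y < len (J - 1) \<and> even (y + J)"
    and "sorted_wrt (>) xs" "\<forall>x\<in>set xs. x < e \<and> odd (x + J)"
  shows "weight (partial_strip J e ys xs) = row_result J e ys xs"
  using assms(3-)
proof (induction e arbitrary: ys xs rule: less_induct)
  case (less e)
  note ys = less.prems(2,3) and xs = less.prems(4,5)
  show ?case
  proof (cases e)
    case 0
    then have "xs = []" using xs(2) by (cases xs) auto
    moreover have "weight (partial_strip J 0 ys []) = row_value J ys []"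
      using ys by (intro IH) blast+
    ultimately show ?thesis
      using 0 by (cases "even J") (simp_all add: row_end_def row_result_def)
  next
    case e: (Suc m)
    have ys_less: "\<forall>y\<in>set ys. m < y" using ys(2) e by (simp add: Suc_le_eq)
    have IH': "weight (partial_strip J k ys xs') = row_result J k ys xs'"
      if "k \<le> m" "sorted_wrt (>) xs'" "\<forall>x\<in>set xs'. x < k \<and> odd (x + J)" for k xs'
    proof (rule less.IH)
      show "\<forall>y\<in>set ys. k \<le> y \<and> y < len (J - 1) \<and> even (y + J)"
        using ys(2) ys_less that(1) by (meson less_imp_le order_trans)
    qed (use that ys(1) less.prems(1) e in simp_all)
    show ?thesis
    proof (cases "even (m + J)")
      case down: True
      have xs_less: "x < m" if "x \<in> set xs" for x
      proof -
        have "x < Suc m" "odd (x + J)" using that xs(2) e by simp_all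
        then show ?thesis using down by (cases "x = m") simp_all
      qed
      have vertical: "weight (partial_strip J m (ys @ [m]) xs) = (if map pos xs @ row_end J = [] then 0
          else row_value J ys (boundary_row (J - 1) (pos m) #
            successive_diffs (boundary_row J) (map pos xs @ row_end J)))"
        if "m < len (J - 1)"
      proof -
        have "weight (partial_strip J m (ys @ [m]) xs) = row_result J m (ys @ [m]) xs"
        proof (rule less.IH)
          show "sorted_wrt (>) (ys @ [m])"
            using ys(1) ys_less by (simp add: sorted_wrt_append)
          have "\<forall>y\<in>set ys. m \<le> y \<and> y < len (J - 1) \<and> even (y + J)"
            using ys(2) ys_less by (meson less_imp_le)
          then show "\<forall>y\<in>set (ys @ [m]). m \<le> y \<and> y < len (J - 1) \<and> even (y + J)"
            using down that by simp
          show "\<forall>x\<in>set xs. x < m \<and> odd (x + J)"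
            using xs(2) xs_less by blast
        qed (use xs(1) less.prems(1) e in simp_all)
        then show ?thesis by (simp only: row_result_even[OF down] row_value_snoc)
      qed
      have no_vertical: "row_value J ys (boundary_row (J - 1) (pos m) #
          successive_diffs (boundary_row J) (map pos xs @ row_end J)) = 0"
        if "\<not> m < len (J - 1)"
        using row_value_dent[OF J down _ that] less.prems(1) e by simp
      have horizontal: "weight (partial_strip J (m - 1) ys xs) =
          row_value J ys (successive_diffs (boundary_row J) (pos (m - 1) # map pos xs @ row_end J))"
        if "m \<noteq> 0" "m - 1 \<notin> set xs"
      proof -
        have "x < m - 1" if "x \<in> set xs" for x
          using xs_less[OF that] \<open>m - 1 \<notin> set xs\<close> that by (cases "x = m - 1") auto
        then have "\<forall>x\<in>set xs. x < m - 1 \<and> odd (x + J)" using xs(2) by blast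
        then have "weight (partial_strip J (m - 1) ys xs) = row_result J (m - 1) ys xs"
          by (intro IH') (use xs(1) in simp_all)
        moreover have "odd (m - 1 + J)" using down that(1) by (cases m) simp_all
        note row_result_odd[OF this, of ys xs]
        ultimately show ?thesis by (rule trans)
      qed
      have "\<forall>x\<in>set xs. odd (x + J)" "\<forall>x\<in>set xs. x < Suc m \<and> odd (x + J)"
        using xs(2) e by blast+
      note steps = weight_down[OF J down ys_less this(1)] row_value_down[OF J down xs(1) this(2), of ys]
      have "(if m = 0 \<or> m - 1 \<in> set xs then 0 else weight (partial_strip J (m - 1) ys xs)) =
          (if m = 0 \<or> m - 1 \<in> set xs then 0 else row_value J ys
            (successive_diffs (boundary_row J) (pos (m - 1) # map pos xs @ row_end J)))"
        by (intro if_cong refl horizontal) simp_all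
      moreover have "(if m < len (J - 1) then r * weight (partial_strip J m (ys @ [m]) xs) else 0) =
          (if map pos xs @ row_end J = [] then 0
           else r * row_value J ys (boundary_row (J - 1) (pos m) #
             successive_diffs (boundary_row J) (map pos xs @ row_end J)))" for r
      proof (cases "m < len (J - 1)")
        case True
        then show ?thesis by (simp only: vertical[OF True] if_True if_distrib[of "(*) r"] mult_zero_right)
      next
        case False
        then show ?thesis by (simp only: no_vertical[OF False] if_False mult_zero_right if_cancel)
      qed
      ultimately have "weight (partial_strip J (Suc m) ys xs) =
          row_value J ys (successive_diffs (boundary_row J) (pos (Suc m) # map pos xs @ row_end J))"
        by (simp only: steps)
      then show ?thesis
        using e down by (simp add: row_result_odd)
    next
      case up: False
      then have e_even: "even (e + J)" using e by simp
      show ?thesis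
      proof (cases "m \<in> set xs")
        case True
        then obtain x xs' where x: "xs = x # xs'" by (cases xs) auto
        have "x = m"
        proof (rule ccontr)
          assume "x \<noteq> m"
          then have "m < x" using True xs(1) x by auto
          then show False using xs(2) x e by simp
        qed
        \<comment> \<open>The removed leftmost triangle \<open>m\<close> becomes the leading
          position \<open>pos m\<close> of the shorter row.\<close>
        then have "weight (partial_strip J e ys xs) = weight (partial_strip J m ys xs')"
          using e x by (simp add: partial_strip_removed)
        also have "\<dots> = row_result J m ys xs'"
          by (rule IH') (use xs x \<open>x = m\<close> in simp_all)
        finally show ?thesis
          using up x \<open>x = m\<close> by (simp add: row_result_odd row_result_even[OF e_even])
      next
        case m: False
        show ?thesis
        proof (cases m)
          case 0
          then have "xs = []" using xs(2) m e by (cases xs) auto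
          moreover have "odd J" using up 0 by simp
          ultimately show ?thesis
            using weight_up_0[of J xs ys] e 0 by (simp add: row_end_def row_result_def)
        next
          case k: (Suc k)
          then have "even (k + J)" using up by simp
          have "x < k" if "x \<in> set xs" for x
          proof -
            have "x < Suc (Suc k)" "odd (x + J)" using that xs(2) e k by simp_all
            moreover have "x \<noteq> Suc k" using that m k by blast
            ultimately show ?thesis using \<open>even (k + J)\<close> by (cases "x = k") simp_all
          qed
          then have "\<forall>x\<in>set xs. x < k \<and> odd (x + J)" using xs(2) by blast
          then have "weight (partial_strip J k ys xs) = row_result J k ys xs"
            by (intro IH') (use xs(1) k in simp_all)
          moreover have "weight (partial_strip J e ys xs) = weight (partial_strip J k ys xs)"
            unfolding e k
          proof (rule weight_up[OF \<open>even (k + J)\<close>])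
            show "\<forall>x\<in>set xs. odd (x + J)" using xs(2) by blast
            show "Suc k \<notin> set xs" using m k by simp
          qed
          ultimately show ?thesis
            by (simp only: row_result_even[OF e_even] row_result_even[OF \<open>even (k + J)\<close>])
        qed
      qed
    qed
  qed
qed

lemma dent_rows_step:
  assumes "J \<ge> 1"
  shows "dent_rows J = dent_rows (J - 1) @ (if odd (c J + J) then [boundary_row J (pos (len J))] else [])"
proof -
  have "[1..<Suc J] = [1..<Suc (J - 1)] @ [J]" using assms by simp
  then show ?thesis unfolding dent_rows_def dents_def by simp
qed

lemma dent_rows_eq_0:
  assumes "u \<in> set (dent_rows J)" "J \<le> 2 * i"
  shows "u i = 0"
  using assms by (auto simp: dent_rows_def dents_def boundary_row_def)

text \<open>Differences are converted back into rows: in even rows through the final 0, in odd rows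
  through a new column of ones, which is why the size grows only there.\<close>

lemma weight_strip:
  assumes "sorted_wrt (>) xs" "\<forall>x\<in>set xs. x < len J \<and> odd (x + J)"
  shows "weight (partial_strip J (len J) [] xs) =
    row_det ((J + 1) div 2) (dent_rows J @ map (\<lambda>x. boundary_row J (pos x)) xs)"
  using assms
proof (induction J arbitrary: xs)
  case 0
  then have "xs = []" by (cases xs) (auto simp: len_def)
  moreover have "partial_strip 0 (len 0) [] [] = {}"
    by (auto simp: partial_strip_def len_def)
  ultimately show ?case
    by (simp add: dent_rows_def dents_def row_det_def)
next
  case (Suc J')
  define J where "J = Suc J'"
  then have J: "J \<ge> 1" by simp
  let ?V = "boundary_row J"
  let ?cs = "dent_rows (J - 1)"
  let ?zs = "map pos xs @ row_end J"
  have IH: "weight (partial_strip J 0 ys []) = row_value J ys []"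
    if "sorted_wrt (>) ys" "\<forall>y\<in>set ys. y < len (J - 1) \<and> even (y + J)" for ys
  proof -
    have "\<forall>y\<in>set ys. y < len J' \<and> odd (y + J')" using that(2) J_def by simp
    from Suc.IH[OF that(1) this] partial_strip_0[OF J] show ?thesis
      by (simp add: row_value_def J_def)
  qed
  have xs: "sorted_wrt (>) xs" "\<forall>x\<in>set xs. x < len J \<and> odd (x + J)"
    using Suc.prems J_def by simp_all
  \<comment> \<open>A dent of row \<open>J\<close> acts as one more removed triangle, at the western
    end.\<close>
  define zs where "zs = (if odd (c J + J) then [pos (len J)] else []) @ map pos xs"
  have parity: "even (len J + J) = even (c J + J)"
    using J by (simp add: len_def)
  have "weight (partial_strip J (len J) [] xs) = row_result J (len J) [] xs"
  proof (rule weight_partial_strip[OF J])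
    show "weight (partial_strip J 0 ys []) = row_value J ys []"
      if "sorted_wrt (>) ys" "\<forall>y\<in>set ys. y < len (J - 1) \<and> even (y + J)" for ys
      using that by (rule IH)
  qed (use xs in simp_all)
  also have "\<dots> = (if zs @ row_end J = [] then 0
      else row_value J [] (successive_diffs ?V (zs @ row_end J)))"
    unfolding row_result_def Let_def parity zs_def by (cases "even (c J + J)") simp_all
  also have "\<dots> = row_det ((J + 1) div 2) (?cs @ map ?V zs)"
  proof (cases "even J")
    case True
    have "row_value J [] (successive_diffs ?V (zs @ [0])) = row_det (J div 2) (?cs @ map ?V zs)"
      unfolding row_value_def
      using row_det_successive_diffs_zero[of ?V "J div 2" ?cs zs] boundary_row_zero[OF True] by simp
    then show ?thesis using True by (simp add: row_end_def)
  next
    case False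
    then have half: "2 * (J div 2) = J - 1" "(J + 1) div 2 = Suc (J div 2)" by presburger+
    \<comment> \<open>Column \<open>J div 2\<close> is the new one: the guard gives 0 in the earlier
      rows, while in row \<open>J\<close> the central binomial has index 0.\<close>
    have cs: "\<forall>u\<in>set ?cs. u (J div 2) = 0"
      using dent_rows_eq_0[of _ "J - 1" "J div 2"] half by simp
    have V: "?V x (J div 2) = 1" for x
      using half J by (simp add: boundary_row_def)
    show ?thesis
    proof (cases "zs = []")
      case True
      then show ?thesis
        using row_det_last_column_0[OF cs] half False by (simp add: row_end_def)
    next
      case zs: False
      then show ?thesis
        using row_det_successive_diffs_extend[of ?cs "J div 2" ?V, OF cs V zs] half False
        by (simp add: row_end_def row_value_def)
    qed
  qed
  also have "?cs @ map ?V zs = dent_rows J @ map (\<lambda>x. ?V (pos x)) xs"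
    using dent_rows_step[OF J] by (simp add: zs_def)
  finally show ?case by (simp add: J_def)
qed

end

section \<open>The two models as values of one polynomial\<close>

lemma weighted_tilings_V_plus:
  assumes u: "\<forall>i\<in>{1..n}. 1 \<le> u i \<and> u i \<le> b + 2 * n"
    and strip: "half_strip a (row_length b n u) \<delta> w"
  shows "weighted_tilings w (V_plus a b n u) =
    row_det (b + n) (map (\<lambda>j. boundary_row j (2 * real a + \<delta> + real (row_length b n u j)))
      (filter (\<lambda>j. odd (row_length b n u j + j)) [1..<Suc (2 * b + 2 * n)]))"
proof -
  interpret half_strip a "row_length b n u" \<delta> w by (rule strip)
  let ?N = "2 * b + 2 * n"
  have "1 \<le> j \<and> j \<le> N \<and> d < 2 * a + row_length b n u j \<longleftrightarrow>
      1 \<le> j \<and> j < N \<and> d < len j \<and> \<not> (j = N - 1 \<and> d \<in> set []) \<or> j = N \<and> d < len N \<and> d \<notin> set []"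
    for d j N by (cases "j = N") (auto simp: len_def)
  then have "V_plus a b n u = partial_strip ?N (len ?N) [] []"
    by (simp only: V_plus_eq[OF u] partial_strip_def tri_at_def)
  then have "weighted_tilings w (V_plus a b n u) = row_det ((?N + 1) div 2) (dent_rows ?N)"
    using weight_strip[of "[]" ?N] by simp
  also have "(?N + 1) div 2 = b + n" by simp
  also have "dent_rows ?N =
      map (\<lambda>j. boundary_row j (2 * real a + \<delta> + real (row_length b n u j)))
        (filter (\<lambda>j. odd (row_length b n u j + j)) [1..<Suc ?N])"
    by (auto simp: dent_rows_def dents_def len_def pos_def algebra_simps)
  finally show ?thesis .
qed

lemma half_strip_unweighted: "half_strip a (row_length b n u) 1 (\<lambda>_. 1)"
proof unfold_locales
  show "row_length b n u j \<le>
      row_length b n u (j - 1) + (if even (row_length b n u j + j) then 2 else 1)"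
    if "2 \<le> j" for j using that by (rule row_length_le)
qed simp_all

lemma half_strip_axis_weight: "half_strip a (row_length b n u) 0 (axis_weight a)"
proof unfold_locales
  show "row_length b n u j \<le>
      row_length b n u (j - 1) + (if even (row_length b n u j + j) then 2 else 1)"
    if "2 \<le> j" for j using that by (rule row_length_le)
qed (simp_all add: axis_weight_horizontal axis_weight_vertical)

theorem mainTheorem6:
  fixes b n :: nat and u :: "nat \<Rightarrow> nat"
  assumes "strict_mono_on {1..n} u"
    and "\<forall>i\<in>{1..n}. 1 \<le> u i \<and> u i \<le> b + 2 * n"
  shows "\<exists>p q :: real poly.
           (\<forall>a::nat. poly p (real a) = f_plus b n u a) \<and>
           (\<forall>a::nat. poly q (real a) = fbar_plus b n u a) \<and>
           (\<forall>x::real. poly q x = poly p (x - 1 / 2))"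
proof -
  let ?c = "row_length b n u"
  let ?js = "filter (\<lambda>j. odd (?c j + j)) [1..<Suc (2 * b + 2 * n)]"
  \<comment> \<open>The variable \<open>x\<close> stands for \<open>2 * a + \<delta>\<close>; all
    else in the determinant is independent of \<open>a\<close> and of the model.\<close>
  obtain P where P: "\<And>x. poly P x =
      row_det (b + n) (map (\<lambda>j. boundary_row j (x + real (?c j))) ?js)"
    using ex_poly_row_det[of "\<lambda>j x. boundary_row j (x + real (?c j))" "b + n" ?js]
      ex_poly_boundary_row by blast
  have f: "f_plus b n u a = poly P (2 * real a + 1)" for a
    using weighted_tilings_V_plus[OF assms(2) half_strip_unweighted]
    by (simp add: f_plus_def P)
  have fbar: "fbar_plus b n u a = poly P (2 * real a)" for a
    using weighted_tilings_V_plus[OF assms(2) half_strip_axis_weight]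
    by (simp add: fbar_plus_def P)
  show ?thesis
    \<comment> \<open>The witnesses are \<open>P (2 * x + 1)\<close> and \<open>P (2 * x)\<close>;
      replacing \<open>x\<close> by \<open>x - 1/2\<close> in the first gives the second.\<close>
    by (rule exI[of _ "pcompose P [:1, 2:]"], rule exI[of _ "pcompose P [:0, 2:]"])
      (simp add: f fbar poly_pcompose algebra_simps)
qed

end
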